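(* For $m\ge 1$ consider the words \[ w_m=a^m b^m (ab)^m \] in $F(a,b)$, whose freely reduced length and cyclically reduced length both equal $4m$. Then: (1) The $\mathbb Z[x,y]$-coefficient $g_m(x,y)$ of $z^{m+1}$ in $f_{w_m}$ (viewed as a polynomial in $z$ over $\mathbb Z[x,y]$) is equal to $E_m(x)E_m(y)$. (2) $\#\mathrm{supp}(f_{w_m})=\Omega(m^2)$. (3) $\|g_m\|_{\mathrm{bit},1}=\Omega(m^3)$. In particular, $\|f_{w_m}\|_{\mathrm{bit},1}=\Omega(m^3)$. (4) Any algorithm which outputs the trace polynomial $f_w$ in fully expanded sparse binary form has worst-case output size, and therefore worst-case running time, at least $\Omega(n^3)$ for words of length $n$.
   Context: $F(a,b)$ is the free group on $a,b$. For $w\in F(a,b)$ and $A,B\in \mathrm{SL}(2,\mathbb C)$, $w(A,B)$ denotes the image of $w$ under $a\mapsto A$, $b\mapsto B$. The trace polynomial $f_w(x,y,z)\in\mathbb Z[x,y,z]$ is the unique polynomial such that $\mathrm{Tr}(w(A,B))=f_w(\mathrm{Tr}A,\mathrm{Tr}B,\mathrm{Tr}(AB))$ for all $A,B\in \mathrm{SL}(2,\mathbb C)$ (its existence and uniqueness are classical). $\mathrm{supp}(f)$ is the set of monomials occurring with nonzero coefficient in $f$. For a nonzero integer $m$, $\mathrm{bit}(m)$ is the length of the binary expansion of $|m|$. For a polynomial $f$ with integer coefficients, $\|f\|_{\mathrm{bit},1}$ is the sum of $\mathrm{bit}(c)$ over all nonzero coefficients $c$ of $f$. For $m\ge1$,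 $E_m(t)=U_{m-1}(t/2)\in\mathbb Z[t]$, where $U_j$ is the Chebyshev polynomial of the second kind ($U_j(\cos\theta)\sin\theta=\sin((j+1)\theta)$); thus $\deg E_m=m-1$. Fully expanded sparse binary form: the output is an explicit list of all monomials with nonzero coefficient in $f_w$ (with enough data to identify their exponents), each together with its coefficient written in binary. *)

theory Defs
  imports
    "HOL-Analysis.Analysis"
    "HOL-Computational_Algebra.Polynomial"
    "HOL-Library.Landau_Symbols"
begin

section \<open>The free group on two generators\<close>

datatype gen = GenA | GenB

text \<open>The letter \<open>(g, False)\<close> is the generator \<open>g\<close>, the letter \<open>(g, True)\<close> its formal inverse.\<close>

type_synonym letter = "gen \<times> bool"

definition letter_inv :: "letter \<Rightarrow> letter" where
  "letter_inv l = (fst l, \<not> snd l)"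

definition freely_reduced :: "letter list \<Rightarrow> bool" where
  "freely_reduced w \<longleftrightarrow> successively (\<lambda>k l. l \<noteq> letter_inv k) w"

fun push_letter :: "letter \<Rightarrow> letter list \<Rightarrow> letter list" where
  "push_letter l [] = [l]"
| "push_letter l (k # w) = (if k = letter_inv l then w else l # k # w)"

definition free_reduce :: "letter list \<Rightarrow> letter list" where
  "free_reduce w = foldr push_letter w []"

lemma letter_inv_inv [simp]: "letter_inv (letter_inv l) = l"
  by (simp add: letter_inv_def)

lemma letter_inv_neq [simp]: "letter_inv l \<noteq> l" "l \<noteq> letter_inv l"
  by (auto simp: letter_inv_def prod_eq_iff)

lemma freely_reduced_Nil [simp]: "freely_reduced []"
  by (simp add: freely_reduced_def)

lemma freely_reduced_singleton [simp]: "freely_reduced [l]"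
  by (simp add: freely_reduced_def)

lemma freely_reduced_Cons:
  "freely_reduced (l # w) \<longleftrightarrow> (w = [] \<or> hd w \<noteq> letter_inv l) \<and> freely_reduced w"
  by (cases w) (auto simp: freely_reduced_def)

lemma freely_reduced_push: "freely_reduced w \<Longrightarrow> freely_reduced (push_letter l w)"
  by (cases w) (auto simp: freely_reduced_Cons)

lemma freely_reduced_foldr_push:
  "freely_reduced v \<Longrightarrow> freely_reduced (foldr push_letter u v)"
  by (induction u) (auto intro: freely_reduced_push)

lemma freely_reduced_free_reduce [simp]: "freely_reduced (free_reduce w)"
  by (simp add: free_reduce_def freely_reduced_foldr_push)

lemma push_letter_inv_cancel:
  "freely_reduced w \<Longrightarrow> push_letter l (push_letter (letter_inv l) w) = w"
  by (cases w; cases "tl w") (auto simp: freely_reduced_Cons)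

lemma foldr_push_push:
  assumes "freely_reduced v"
  shows "foldr push_letter (push_letter l u) v = push_letter l (foldr push_letter u v)"
proof (cases u)
  case (Cons k u')
  show ?thesis
  proof (cases "k = letter_inv l")
    case True
    then show ?thesis
      using Cons push_letter_inv_cancel[OF freely_reduced_foldr_push[OF assms]] by simp
  qed (simp add: Cons)
qed simp

lemma foldr_push_foldr_push:
  "freely_reduced w \<Longrightarrow>
    foldr push_letter (foldr push_letter u v) w = foldr push_letter u (foldr push_letter v w)"
  by (induction u) (simp_all add: foldr_push_push freely_reduced_foldr_push)

lemma foldr_push_free_reduce:
  "freely_reduced v \<Longrightarrow> foldr push_letter (free_reduce u) v = foldr push_letter u v"
  by (simp add: free_reduce_def foldr_push_foldr_push)

lemma free_reduce_reduced: "freely_reduced w \<Longrightarrow> free_reduce w = w"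
proof (induction w)
  case (Cons l w)
  then have "free_reduce w = w" "w = [] \<or> hd w \<noteq> letter_inv l"
    by (auto simp: freely_reduced_Cons)
  then show ?case
    by (cases w) (auto simp: free_reduce_def)
qed (simp add: free_reduce_def)

lemma free_reduce_append: "free_reduce (u @ v) = foldr push_letter u (free_reduce v)"
  by (simp add: free_reduce_def)

text \<open>The elements of \<open>F(a,b)\<close> are the freely reduced words; the product is concatenation followed
  by free reduction.\<close>

typedef free_grp = "{w :: letter list. freely_reduced w}"
  morphisms reduced_word Abs_free_grp
  by (rule exI[of _ "[]"]) simp

setup_lifting type_definition_free_grp

lemma freely_reduced_reduced_word [simp]: "freely_reduced (reduced_word g)"
  using reduced_word by simp

instantiation free_grp :: monoid_mult
begin

lift_definition one_free_grp :: free_grp is "[]" by simp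

lift_definition times_free_grp :: "free_grp \<Rightarrow> free_grp \<Rightarrow> free_grp" is
  "\<lambda>u v. free_reduce (u @ v)" by simp

instance
proof
  fix g h k :: free_grp
  show "g * h * k = g * (h * k)"
    by transfer (simp add: free_reduce_append foldr_push_free_reduce
        foldr_push_foldr_push freely_reduced_foldr_push free_reduce_reduced)
  show "1 * g = g" by transfer (simp add: free_reduce_reduced)
  show "g * 1 = g" by transfer (simp add: free_reduce_reduced)
qed

end

lift_definition gen_a :: free_grp is "[(GenA, False)]" by simp
lift_definition gen_b :: free_grp is "[(GenB, False)]" by simp

instantiation free_grp :: inverse
begin

lift_definition inverse_free_grp :: "free_grp \<Rightarrow> free_grp" is
  "\<lambda>w. free_reduce (rev (map letter_inv w))" by simp

definition divide_free_grp :: "free_grp \<Rightarrow> free_grp \<Rightarrow> free_grp" where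
  "divide_free_grp g h = g * inverse h"

instance ..

end

lemma free_grp_left_inverse: "inverse g * g = (1 :: free_grp)"
proof (transfer)
  fix w :: "letter list"
  assume "freely_reduced w"
  have "foldr push_letter (rev (map letter_inv w)) w = []" if "freely_reduced w"
    for w :: "letter list"
    using that
  proof (induction w)
    case (Cons l w)
    then show ?case by (simp add: freely_reduced_Cons)
  qed simp
  then show "free_reduce (free_reduce (rev (map letter_inv w)) @ w) = []"
    using \<open>freely_reduced w\<close>
    by (simp add: free_reduce_append free_reduce_reduced foldr_push_free_reduce)
qed

definition red_length :: "free_grp \<Rightarrow> nat" where
  "red_length g = length (reduced_word g)"

text \<open>Cyclic reduction: strip the first and the last letter as long as they are mutually inverse.\<close>

function cyclic_reduce :: "letter list \<Rightarrow> letter list" where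
  "cyclic_reduce w =
     (if length w \<ge> 2 \<and> last w = letter_inv (hd w) then cyclic_reduce (butlast (tl w)) else w)"
  by auto
termination by (relation "Wellfounded.measure length") auto

declare cyclic_reduce.simps [simp del]

definition cyc_length :: "free_grp \<Rightarrow> nat" where
  "cyc_length g = length (cyclic_reduce (reduced_word g))"

definition word_w :: "nat \<Rightarrow> free_grp" where
  "word_w m = gen_a ^ m * gen_b ^ m * (gen_a * gen_b) ^ m"


section \<open>Trace polynomials\<close>

definition SL2 :: "(complex^2^2) set" where
  "SL2 = {A. det A = 1}"

definition letter_mat :: "complex^2^2 \<Rightarrow> complex^2^2 \<Rightarrow> letter \<Rightarrow> complex^2^2" where
  "letter_mat A B l =
     (let M = (case fst l of GenA \<Rightarrow> A | GenB \<Rightarrow> B) in if snd l then matrix_inv M else M)"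

definition list_mat :: "complex^2^2 \<Rightarrow> complex^2^2 \<Rightarrow> letter list \<Rightarrow> complex^2^2" where
  "list_mat A B w = foldr (\<lambda>l M. letter_mat A B l ** M) w (mat 1)"

definition word_mat :: "complex^2^2 \<Rightarrow> complex^2^2 \<Rightarrow> free_grp \<Rightarrow> complex^2^2" where
  "word_mat A B g = list_mat A B (reduced_word g)"

lemma matrix_inv_inverse:
  assumes "invertible (A :: complex^2^2)"
  shows "A ** matrix_inv A = mat 1" "matrix_inv A ** A = mat 1"
proof -
  have "\<exists>A'. A ** A' = mat 1 \<and> A' ** A = mat 1"
    using assms by (simp add: invertible_def)
  then have "A ** matrix_inv A = mat 1 \<and> matrix_inv A ** A = mat 1"
    unfolding matrix_inv_def by (rule someI_ex)
  then show "A ** matrix_inv A = mat 1" "matrix_inv A ** A = mat 1" by auto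
qed

lemma letter_mat_inv_cancel:
  assumes "A \<in> SL2" "B \<in> SL2"
  shows "letter_mat A B l ** letter_mat A B (letter_inv l) = mat 1"
proof -
  have "invertible A" "invertible B"
    using assms by (auto simp: SL2_def invertible_det_nz)
  then show ?thesis
    by (cases "fst l"; cases "snd l")
      (simp_all add: letter_mat_def letter_inv_def matrix_inv_inverse)
qed

lemma list_mat_push:
  assumes "A \<in> SL2" "B \<in> SL2"
  shows "list_mat A B (push_letter l w) = letter_mat A B l ** list_mat A B w"
proof (cases w)
  case (Cons k w')
  then show ?thesis
    using letter_mat_inv_cancel[OF assms, of l]
    by (auto simp: list_mat_def matrix_mul_assoc)
qed (simp add: list_mat_def)

text \<open>For \<open>A, B\<close> in \<open>SL(2,\<complex>)\<close>, the map \<^term>\<open>word_mat A B\<close> is the homomorphism that extends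
  \<open>a \<mapsto> A\<close>, \<open>b \<mapsto> B\<close>.\<close>

lemma word_mat_hom:
  assumes "A \<in> SL2" "B \<in> SL2"
  shows "word_mat A B 1 = mat 1"
    and "word_mat A B (g * h) = word_mat A B g ** word_mat A B h"
    and "word_mat A B gen_a = A"
    and "word_mat A B gen_b = B"
proof -
  have foldr_push: "list_mat A B (foldr push_letter u v) = list_mat A B u ** list_mat A B v" for u v
    by (induction u) (simp_all add: list_mat_push[OF assms], simp_all add: list_mat_def matrix_mul_assoc)
  show "word_mat A B (g * h) = word_mat A B g ** word_mat A B h"
    by (simp add: word_mat_def times_free_grp.rep_eq free_reduce_append free_reduce_reduced foldr_push)
qed (simp_all add: word_mat_def list_mat_def letter_mat_def one_free_grp.rep_eq
      gen_a.rep_eq gen_b.rep_eq)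

text \<open>\<open>\<int>[x,y]\<close> is \<^typ>\<open>int poly poly\<close> and \<open>\<int>[x,y,z]\<close> is \<^typ>\<open>int poly poly poly\<close>: the innermost
  variable is \<open>x\<close>, the next one \<open>y\<close>, and (for three variables) the outermost one is \<open>z\<close>.
  The pair \<open>(i, j)\<close> and the triple \<open>(i, j, k)\<close> stand for the monomials \<open>x^i y^j\<close> and
  \<open>x^i y^j z^k\<close>.\<close>

definition coeff2 :: "int poly poly \<Rightarrow> nat \<times> nat \<Rightarrow> int" where
  "coeff2 g = (\<lambda>(i, j). coeff (coeff g j) i)"

definition coeff3 :: "int poly poly poly \<Rightarrow> nat \<times> nat \<times> nat \<Rightarrow> int" where
  "coeff3 f = (\<lambda>(i, j, k). coeff (coeff (coeff f k) j) i)"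

definition eval3 :: "int poly poly poly \<Rightarrow> complex \<Rightarrow> complex \<Rightarrow> complex \<Rightarrow> complex" where
  "eval3 f x y z =
     poly (map_poly (\<lambda>g. poly (map_poly (\<lambda>h. poly (map_poly of_int h) x) g) y) f) z"

definition trace_poly :: "free_grp \<Rightarrow> int poly poly poly" where
  "trace_poly w = (THE f. \<forall>A\<in>SL2. \<forall>B\<in>SL2.
     trace (word_mat A B w) = eval3 f (trace A) (trace B) (trace (A ** B)))"

definition supp3 :: "int poly poly poly \<Rightarrow> (nat \<times> nat \<times> nat) set" where
  "supp3 f = {e. coeff3 f e \<noteq> 0}"

definition g_poly :: "nat \<Rightarrow> int poly poly" where
  "g_poly m = coeff (trace_poly (word_w m)) (m + 1)"


section \<open>Chebyshev polynomials\<close>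

definition cheb_U :: "nat \<Rightarrow> real poly" where
  "cheb_U j = (THE p. \<forall>\<theta>. poly p (cos \<theta>) * sin \<theta> = sin (real (j + 1) * \<theta>))"

definition E_poly :: "nat \<Rightarrow> int poly" where
  "E_poly m = (THE e. map_poly real_of_int e = pcompose (cheb_U (m - 1)) [:0, 1 / 2:])"

definition in_x :: "int poly \<Rightarrow> int poly poly" where
  "in_x p = [:p:]"

definition in_y :: "int poly \<Rightarrow> int poly poly" where
  "in_y p = map_poly (\<lambda>c. [:c:]) p"


section \<open>Bit length\<close>

text \<open>Most significant digit first, no leading zeros (so \<open>0\<close> has the empty expansion).\<close>

fun binary :: "nat \<Rightarrow> bool list" where
  "binary n = (if n = 0 then [] else binary (n div 2) @ [odd n])"

declare binary.simps [simp del]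

definition bit_length :: "int \<Rightarrow> nat" where
  "bit_length c = length (binary (nat \<bar>c\<bar>))"

definition bit_norm2 :: "int poly poly \<Rightarrow> nat" where
  "bit_norm2 g = (\<Sum>e | coeff2 g e \<noteq> 0. bit_length (coeff2 g e))"

definition bit_norm3 :: "int poly poly poly \<Rightarrow> nat" where
  "bit_norm3 f = (\<Sum>e \<in> supp3 f. bit_length (coeff3 f e))"


section \<open>Fully expanded sparse binary form\<close>

text \<open>Monomials are encoded by strings over an arbitrary alphabet \<open>'e\<close>.\<close>

datatype 'e out_sym = Expo 'e | Minus | Digit bool | Sep

definition coeff_code :: "int \<Rightarrow> 'e out_sym list" where
  "coeff_code c = (if c < 0 then [Minus] else []) @ map Digit (binary (nat \<bar>c\<bar>))"

text \<open>In the list \<open>ts\<close>, each monomial of the support, listed exactly once and in any order, is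
  paired with its exponent data. The way in which the data identify the monomials is an arbitrary
  decoding function \<open>dec\<close>. It reads the whole list of data, so that formats which, for example,
  store the difference to the previous exponents are included.\<close>

definition sparse_binary_form ::
  "('e list list \<Rightarrow> (nat \<times> nat \<times> nat) list) \<Rightarrow> int poly poly poly \<Rightarrow> 'e out_sym list \<Rightarrow> bool" where
  "sparse_binary_form dec f s \<longleftrightarrow> (\<exists>ts :: ((nat \<times> nat \<times> nat) \<times> 'e list) list.
     distinct (map fst ts) \<and> set (map fst ts) = supp3 f \<and>
     dec (map snd ts) = map fst ts \<and>
     s = concat (map (\<lambda>(e, d). map Expo d @ coeff_code (coeff3 f e) @ [Sep]) ts))"


section \<open>Algorithms\<close>

text \<open>Algorithms are deterministic multi-tape Turing machines with states \<open>'q\<close>, tapes indexed by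
  \<open>'k\<close> and additional work symbols \<open>'w\<close> (all finite where machines are quantified over). The input
  tape and the output tape may coincide, so single-tape machines are included. All tapes are
  infinite in both directions. A machine halts when its transition function is undefined.\<close>

datatype ('e, 'w) tape_sym = Blank | In letter | Out "'e out_sym" | Work 'w

datatype move = MoveLeft | Stay | MoveRight

record ('q, 'k, 's) machine =
  start_state :: 'q
  in_tape :: 'k
  out_tape :: 'k
  trans :: "'q \<Rightarrow> ('k \<Rightarrow> 's) \<Rightarrow> ('q \<times> ('k \<Rightarrow> 's \<times> move)) option"

record ('q, 'k, 's) config =
  state :: 'q
  cells :: "'k \<Rightarrow> int \<Rightarrow> 's"
  head :: "'k \<Rightarrow> int"

fun move_by :: "move \<Rightarrow> int" where
  "move_by MoveLeft = -1"
| "move_by Stay = 0"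
| "move_by MoveRight = 1"

definition next_action ::
  "('q, 'k, 's) machine \<Rightarrow> ('q, 'k, 's) config \<Rightarrow> ('q \<times> ('k \<Rightarrow> 's \<times> move)) option" where
  "next_action M c = trans M (state c) (\<lambda>k. cells c k (head c k))"

definition halted :: "('q, 'k, 's) machine \<Rightarrow> ('q, 'k, 's) config \<Rightarrow> bool" where
  "halted M c \<longleftrightarrow> next_action M c = None"

definition step :: "('q, 'k, 's) machine \<Rightarrow> ('q, 'k, 's) config \<Rightarrow> ('q, 'k, 's) config" where
  "step M c = (case next_action M c of
       None \<Rightarrow> c
     | Some (q, act) \<Rightarrow>
         \<lparr>state = q,
          cells = (\<lambda>k. (cells c k)(head c k := fst (act k))),
          head = (\<lambda>k. head c k + move_by (snd (act k)))\<rparr>)"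

definition init_config ::
  "('q, 'k, ('e, 'w) tape_sym) machine \<Rightarrow> free_grp \<Rightarrow> ('q, 'k, ('e, 'w) tape_sym) config" where
  "init_config M w =
     \<lparr>state = start_state M,
      cells = (\<lambda>k i. if k = in_tape M \<and> 0 \<le> i \<and> i < int (red_length w)
                     then In (reduced_word w ! nat i) else Blank),
      head = (\<lambda>k. 0)\<rparr>"

definition run ::
  "('q, 'k, ('e, 'w) tape_sym) machine \<Rightarrow> free_grp \<Rightarrow> nat \<Rightarrow> ('q, 'k, ('e, 'w) tape_sym) config" where
  "run M w t = (step M ^^ t) (init_config M w)"

definition halts :: "('q, 'k, ('e, 'w) tape_sym) machine \<Rightarrow> free_grp \<Rightarrow> bool" where
  "halts M w \<longleftrightarrow> (\<exists>t. halted M (run M w t))"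

definition running_time :: "('q, 'k, ('e, 'w) tape_sym) machine \<Rightarrow> free_grp \<Rightarrow> nat" where
  "running_time M w = (LEAST t. halted M (run M w t))"

text \<open>The output is the content of the output tape from cell \<open>0\<close> up to the first blank cell.\<close>

definition machine_output ::
  "('q, 'k, ('e, 'w) tape_sym) machine \<Rightarrow> free_grp \<Rightarrow> ('e, 'w) tape_sym list" where
  "machine_output M w =
     (let tape = cells (run M w (running_time M w)) (out_tape M)
      in map (\<lambda>i. tape (int i)) [0..<(LEAST n. tape (int n) = Blank)])"

definition computes_trace_poly ::
  "('q, 'k, ('e, 'w) tape_sym) machine \<Rightarrow> ('e list list \<Rightarrow> (nat \<times> nat \<times> nat) list) \<Rightarrow> bool" where
  "computes_trace_poly M dec \<longleftrightarrow> (\<forall>w. halts M w \<and>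
     (\<exists>s. sparse_binary_form dec (trace_poly w) s \<and> machine_output M w = map Out s))"

definition worst_output_size :: "('q, 'k, ('e, 'w) tape_sym) machine \<Rightarrow> nat \<Rightarrow> nat" where
  "worst_output_size M n = Max ((\<lambda>w. length (machine_output M w)) ` {w. red_length w = n})"

definition worst_running_time :: "('q, 'k, ('e, 'w) tape_sym) machine \<Rightarrow> nat \<Rightarrow> nat" where
  "worst_running_time M n = Max (running_time M ` {w. red_length w = n})"

end

(* By Cayley-Hamilton, a power of a matrix M of determinant 1 is M^n = S_n M - S_(n-1), where S_n = E_n
   is evaluated at the trace of M. Inserting this into A^p B^q (AB)^k leaves traces of A, B, AB, (AB)^2,
   A(AB) and B(AB); only the term with (AB)^2 reaches z^(k+1), so the coefficient is E_p(x) E_q(y).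
   The coefficients of E_m are, up to sign, the binomials C(m-1-i, i), which are at least 2^i for
   i <= (m-1)/3; hence about m^2 coefficients of the product have about m bits.
   Exponents with p different from q and k are needed only for words whose length is not a
   multiple of 4. *)

theory Submission
  imports Defs
begin

section \<open>Chebyshev recursion in a commutative ring\<close>

text \<open>\<open>chebS m\<close> is E_m, that is U_(m-1)(x/2), with the value 0 at index 0. The
  argument lives in any commutative ring because it is an indeterminate where coefficients are read
  off and a complex trace where matrices are involved.\<close>

fun chebS :: "nat \<Rightarrow> 'a::comm_ring_1 \<Rightarrow> 'a" where
  "chebS 0 x = 0"
| "chebS (Suc 0) x = 1"
| "chebS (Suc (Suc n)) x = x * chebS (Suc n) x - chebS n x"

text \<open>Evaluations and coefficient embeddings all commute with \<open>chebS\<close> and with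
  \<open>trace_formula\<close>; one locale covers all these instances.\<close>

locale comm_ring_map =
  fixes h :: "'a::comm_ring_1 \<Rightarrow> 'b::comm_ring_1"
  assumes map_one [simp]: "h 1 = 1"
    and map_add [simp]: "h (a + b) = h a + h b"
    and map_mult [simp]: "h (a * b) = h a * h b"
begin

lemma map_zero [simp]: "h 0 = 0"
  using map_add[of 0 0] by simp

lemma map_uminus [simp]: "h (- a) = - h a"
  using map_add[of a "- a"] by (simp add: eq_neg_iff_add_eq_0 add.commute)

lemma map_diff [simp]: "h (a - b) = h a - h b"
  using map_add[of a "- b"] by simp

lemma map_two [simp]: "h 2 = 2"
  using map_add[of 1 1] by simp

lemma map_sum: "h (sum f A) = (\<Sum>i\<in>A. h (f i))"
  by (induction A rule: infinite_finite_induct) auto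

lemma map_chebS: "h (chebS n x) = chebS n (h x)"
  by (induction n x rule: chebS.induct) auto

lemma comm_ring_map_map_poly: "comm_ring_map (map_poly h)"
proof
  show "map_poly h 1 = 1"
    by (rule poly_eqI) (auto simp: coeff_map_poly)
  fix p q
  show "map_poly h (p + q) = map_poly h p + map_poly h q"
    by (rule poly_eqI) (simp add: coeff_map_poly)
  show "map_poly h (p * q) = map_poly h p * map_poly h q"
    by (rule poly_eqI) (simp add: coeff_map_poly coeff_mult map_sum)
qed

text \<open>Three nested applications, one per variable, make \<open>eval3\<close> a ring
  homomorphism.\<close>

lemma comm_ring_map_poly: "comm_ring_map (\<lambda>p. poly (map_poly h p) c)"
proof -
  interpret P: comm_ring_map "map_poly h" by (rule comm_ring_map_map_poly)
  show ?thesis by unfold_locales simp_all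
qed

end

lemma comm_ring_map_const: "comm_ring_map (\<lambda>c. [:c:])"
  by unfold_locales (simp_all add: one_pCons)

lemma comm_ring_map_poly_at: "comm_ring_map (\<lambda>p. poly p c)"
  by unfold_locales simp_all

lemma comm_ring_map_of_int: "comm_ring_map of_int"
  by unfold_locales simp_all

lemma chebS_poly_const: "chebS n [:c:] = [:chebS n c:]"
  by (rule comm_ring_map.map_chebS[OF comm_ring_map_const, symmetric])

section \<open>Coefficients of the Chebyshev polynomials\<close>

lemma coeff_chebS_eq_0: "n \<le> k \<Longrightarrow> coeff (chebS n [:0, 1:]) k = 0"
proof (induction n "[:0, 1 :: 'a:]" arbitrary: k rule: chebS.induct)
  case (3 n)
  then show ?case by (cases k) auto
qed auto

lemma coeff_chebS_lead: "coeff (chebS (Suc k) [:0, 1:]) k = 1"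
  by (induction k) (simp_all add: coeff_chebS_eq_0)

text \<open>Comparing coefficients of x^k in the recursion gives Pascal's rule. The outer induction
  on i supplies the subtracted term, the inner one on k the term multiplied by x.\<close>

lemma coeff_chebS:
  "coeff (chebS (Suc (k + 2 * i)) [:0, 1 :: 'a::comm_ring_1:]) k = (-1) ^ i * of_nat ((k + i) choose i)"
proof (induction i arbitrary: k)
  case 0
  then show ?case by (simp add: coeff_chebS_lead)
next
  case (Suc i)
  note IH = Suc
  show ?case
  proof (induction k)
    case 0
    then show ?case using IH[of 0] by simp
  next
    case (Suc k)
    then show ?case using IH[of "Suc k"] by (simp add: algebra_simps)
  qed
qed

text \<open>The identity sin((n+2)\<theta>) + sin(n\<theta>) = 2 cos \<theta> sin((n+1)\<theta>) is
  the recursion at x = 2 cos \<theta>.\<close>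

lemma chebS_cos: "chebS n (2 * cos \<theta>) * sin \<theta> = sin (real n * \<theta>)" for \<theta> :: real
proof (induction n "2 * cos \<theta>" rule: chebS.induct)
  case (3 n)
  have "real (Suc (Suc n)) * \<theta> = real (Suc n) * \<theta> + \<theta>"
    "real n * \<theta> = real (Suc n) * \<theta> - \<theta>"
    by (simp_all add: algebra_simps)
  then have "sin (real (Suc (Suc n)) * \<theta>) + sin (real n * \<theta>) = 2 * cos \<theta> * sin (real (Suc n) * \<theta>)"
    by (simp only: sin_add sin_diff) simp
  then show ?case using 3 by (simp add: algebra_simps)
qed simp_all

lemma cheb_U_eq: "cheb_U j = chebS (j + 1) [:0, 2:]"
  unfolding cheb_U_def
proof (rule the_equality)
  interpret E: comm_ring_map "\<lambda>p. poly p c" for c :: real by (rule comm_ring_map_poly_at)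
  have eval: "poly (chebS n [:0, 2:]) c = chebS n (2 * c)" for n and c :: real
    using E.map_chebS[of n "[:0, 2:]" c] by (simp add: mult.commute)
  show *: "\<forall>\<theta>. poly (chebS (j + 1) [:0, 2:]) (cos \<theta>) * sin \<theta> = sin (real (j + 1) * \<theta>)"
    using chebS_cos[of "j + 1"] by (simp add: eval del: chebS.simps)
  fix p :: "real poly"
  assume p: "\<forall>\<theta>. poly p (cos \<theta>) * sin \<theta> = sin (real (j + 1) * \<theta>)"
  define d where "d = p - chebS (j + 1) [:0, 2:]"
  \<comment> \<open>Each c in (0,1) is the cosine of an angle with nonzero sine, which can be
    cancelled. Infinitely many zeros then force d = 0.\<close>
  have "poly d c = 0" if "c \<in> {0<..<1}" for c
  proof -
    have "sin (arccos c) \<noteq> 0" "cos (arccos c) = c"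
      using that by (simp_all add: sin_arccos_nonzero)
    moreover have "poly p (cos (arccos c)) * sin (arccos c) =
        poly (chebS (j + 1) [:0, 2:]) (cos (arccos c)) * sin (arccos c)"
      using p * by metis
    ultimately show ?thesis by (simp add: d_def)
  qed
  then have "{0<..<1} \<subseteq> {c. poly d c = 0}" by blast
  then have "infinite {c. poly d c = 0}"
    using infinite_super[OF _ infinite_Ioo[of 0 "1 :: real"]] by simp
  then show "p = chebS (j + 1) [:0, 2:]"
    using poly_roots_finite[of d] by (auto simp: d_def)
qed

text \<open>Substituting x/2 cancels the factor 2 in \<open>cheb_U_eq\<close>, which leaves integer
  coefficients. They are determined because the integers embed injectively into the reals.\<close>

lemma E_poly_eq:
  assumes "m \<ge> 1"
  shows "E_poly m = chebS m [:0, 1:]"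
  unfolding E_poly_def
proof (rule the_equality)
  interpret C: comm_ring_map "\<lambda>p :: real poly. pcompose p [:0, 1 / 2:]"
    by unfold_locales (simp_all add: pcompose_add pcompose_mult pcompose_1)
  interpret I: comm_ring_map "map_poly real_of_int"
    by (rule comm_ring_map.comm_ring_map_map_poly[OF comm_ring_map_of_int])
  have "pcompose (cheb_U (m - 1)) [:0, 1 / 2:] = chebS m [:0, 1:]"
    using assms by (simp add: cheb_U_eq C.map_chebS pcompose_pCons)
  then show *: "map_poly real_of_int (chebS m [:0, 1:]) = pcompose (cheb_U (m - 1)) [:0, 1 / 2:]"
    by (simp add: I.map_chebS map_poly_pCons)
  fix e assume "map_poly real_of_int e = pcompose (cheb_U (m - 1)) [:0, 1 / 2:]"
  with * have "coeff (map_poly real_of_int e) k = coeff (map_poly real_of_int (chebS m [:0, 1:])) k" for k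
    by simp
  then show "e = chebS m [:0, 1:]"
    by (intro poly_eqI) (simp add: coeff_map_poly)
qed


section \<open>Trace polynomials of the words\<close>

definition word3 :: "nat \<Rightarrow> nat \<Rightarrow> nat \<Rightarrow> free_grp" where
  "word3 p q k = gen_a ^ p * gen_b ^ q * (gen_a * gen_b) ^ k"

lemma word_w_eq_word3: "word_w m = word3 m m m"
  by (simp add: word_w_def word3_def)

text \<open>With C = AB and S_n for \<open>chebS n\<close>, this is the expanded trace of (S_(p+1) A
  - S_p)(S_(q+1) B - S_q)(S_(k+1) C - S_k). The four summands belong to AB, A, B and 1 from the
  first two factors; the traces of CC, AC and BC appear as z^2 - 2, x z - y and y z - x.\<close>

definition trace_formula :: "nat \<Rightarrow> nat \<Rightarrow> nat \<Rightarrow> 'a::comm_ring_1 \<Rightarrow> 'a \<Rightarrow> 'a \<Rightarrow> 'a" where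
  "trace_formula p q k x y z =
     chebS (Suc p) x * chebS (Suc q) y * (chebS (Suc k) z * (z * z - 2) - chebS k z * z)
   - chebS (Suc p) x * chebS q y * (chebS (Suc k) z * (x * z - y) - chebS k z * x)
   - chebS p x * chebS (Suc q) y * (chebS (Suc k) z * (y * z - x) - chebS k z * y)
   + chebS p x * chebS q y * (chebS (Suc k) z * z - chebS k z * 2)"

lemma (in comm_ring_map) map_trace_formula:
  "h (trace_formula p q k x y z) = trace_formula p q k (h x) (h y) (h z)"
  by (simp add: trace_formula_def map_chebS del: chebS.simps)

section \<open>Powers and traces in SL(2,C)\<close>

lemma SL2_mult: "A \<in> SL2 \<Longrightarrow> B \<in> SL2 \<Longrightarrow> A ** B \<in> SL2"
  by (simp add: SL2_def det_mul)

text \<open>Cayley-Hamilton turns multiplication by M into the recursion of \<open>chebS\<close>.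
  Exponents start at 1 so that no index -1 occurs.\<close>

lemma word_mat_power:
  assumes "A \<in> SL2" "B \<in> SL2" and M: "word_mat A B g \<in> SL2"
  defines "M \<equiv> word_mat A B g"
  shows "word_mat A B (g ^ Suc n) $ i $ j =
    chebS (Suc n) (trace M) * M $ i $ j - chebS n (trace M) * mat 1 $ i $ j"
proof (induction n arbitrary: i j)
  case 0
  then show ?case by (simp add: M_def)
next
  case (Suc n)
  have det: "M $ 1 $ 1 * M $ 2 $ 2 = 1 + M $ 1 $ 2 * M $ 2 $ 1"
    using M by (simp add: SL2_def M_def det_2 algebra_simps)
  have tr: "trace M = M $ 1 $ 1 + M $ 2 $ 2"
    by (simp add: trace_def sum_2)
  have CH: "(M ** M) $ i $ j = trace M * M $ i $ j - mat 1 $ i $ j" for i j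
    unfolding tr using exhaust_2[of i] exhaust_2[of j] det
    by (auto simp: matrix_matrix_mult_def sum_2 mat_def algebra_simps)
  have "word_mat A B (g ^ Suc (Suc n)) $ i $ j = (M ** word_mat A B (g ^ Suc n)) $ i $ j"
    by (simp add: word_mat_hom[OF assms(1,2)] M_def)
  also have "\<dots> = chebS (Suc n) (trace M) * (M ** M) $ i $ j - chebS n (trace M) * (M ** mat 1) $ i $ j"
    by (simp add: matrix_matrix_mult_def sum_2 Suc.IH algebra_simps del: chebS.simps power_Suc)
  also have "\<dots> = chebS (Suc (Suc n)) (trace M) * M $ i $ j - chebS (Suc n) (trace M) * mat 1 $ i $ j"
    by (simp add: CH algebra_simps)
  finally show ?case .
qed

lemma trace_word3:
  assumes "A \<in> SL2" "B \<in> SL2"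
  shows "trace (word_mat A B (word3 (Suc p) (Suc q) (Suc k))) =
    trace_formula p q k (trace A) (trace B) (trace (A ** B))"
proof -
  note hom = word_mat_hom[OF assms]
  have gens: "word_mat A B gen_a \<in> SL2" "word_mat A B gen_b \<in> SL2"
    "word_mat A B (gen_a * gen_b) \<in> SL2"
    using assms by (simp_all add: hom SL2_mult)
  have tr: "trace M = M $ 1 $ 1 + M $ 2 $ 2" for M :: "complex^2^2"
    by (simp add: trace_def sum_2)
  have mult: "(M ** N) $ i $ j = M $ i $ 1 * N $ 1 $ j + M $ i $ 2 * N $ 2 $ j" for M N :: "complex^2^2" and i j :: 2
    by (simp add: matrix_matrix_mult_def sum_2)
  note pow = word_mat_power[OF assms gens(1), of p] word_mat_power[OF assms gens(2), of q]
    word_mat_power[OF assms gens(3), of k]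
  let ?C = "A ** B"
  have C: "?C \<in> SL2"
    using assms by (rule SL2_mult)
  have det: "M $ 1 $ 1 * M $ 2 $ 2 = 1 + M $ 1 $ 2 * M $ 2 $ 1" if "M \<in> SL2" for M :: "complex^2^2"
    using that by (simp add: SL2_def det_2 algebra_simps)
  have sq: "(M ** M) $ i $ j = trace M * M $ i $ j - mat 1 $ i $ j"
    if "M \<in> SL2" for M :: "complex^2^2" and i j :: 2
    unfolding tr using exhaust_2[of i] exhaust_2[of j] det[OF that]
    by (auto simp: mult mat_def algebra_simps)
  have m1: "mat 1 $ 1 $ 1 = (1::complex)" "mat 1 $ (1::2) $ (2::2) = (0::complex)"
    "mat 1 $ (2::2) $ (1::2) = (0::complex)" "mat 1 $ (2::2) $ (2::2) = (1::complex)"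
    by (simp_all add: mat_def)
  have CC: "trace (?C ** ?C) = trace ?C * trace ?C - 2"
    using C by (simp add: tr[of "?C ** ?C"] sq m1) (simp add: tr algebra_simps)
  have AAB: "trace (A ** ?C) = trace A * trace ?C - trace B"
    using assms by (simp add: matrix_mul_assoc tr[of "A ** A ** B"] mult[of "A ** A"] sq m1)
      (simp add: tr mult algebra_simps)
  \<comment> \<open>Cyclic rotation turns BAB into ABB, where Cayley-Hamilton for B applies.\<close>
  have "trace (B ** ?C) = trace (?C ** B)"
    by (rule trace_mul_sym)
  also have "?C ** B = A ** (B ** B)"
    by (simp add: matrix_mul_assoc)
  also have "trace (A ** (B ** B)) = trace B * trace ?C - trace A"
    using assms by (simp add: tr[of "A ** (B ** B)"] mult[of A "B ** B"] sq m1)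
      (simp add: tr mult algebra_simps)
  finally have BAB: "trace (B ** ?C) = trace B * trace ?C - trace A" .
  \<comment> \<open>The trace is linear in each factor. \<open>M\<close> will be AB; leaving it
    arbitrary keeps the entries of the third factor atomic in the expansion.\<close>
  have lin: "trace (P ** Q ** R) =
        \<alpha> * \<beta> * (\<gamma> * trace (?C ** M) - \<gamma>' * trace ?C)
      - \<alpha> * \<beta>' * (\<gamma> * trace (A ** M) - \<gamma>' * trace A)
      - \<alpha>' * \<beta> * (\<gamma> * trace (B ** M) - \<gamma>' * trace B)
      + \<alpha>' * \<beta>' * (\<gamma> * trace M - \<gamma>' * 2)"
    if PQR: "\<And>i j. P $ i $ j = \<alpha> * A $ i $ j - \<alpha>' * mat 1 $ i $ j"
      "\<And>i j. Q $ i $ j = \<beta> * B $ i $ j - \<beta>' * mat 1 $ i $ j"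
      "\<And>i j. R $ i $ j = \<gamma> * M $ i $ j - \<gamma>' * mat 1 $ i $ j"
    for \<alpha> \<alpha>' \<beta> \<beta>' \<gamma> \<gamma>' and M P Q R :: "complex^2^2"
    unfolding tr mult PQR m1 by (simp add: algebra_simps)
  have "trace (word_mat A B (word3 (Suc p) (Suc q) (Suc k))) =
      chebS (Suc p) (trace A) * chebS (Suc q) (trace B) *
        (chebS (Suc k) (trace ?C) * trace (?C ** ?C) - chebS k (trace ?C) * trace ?C)
      - chebS (Suc p) (trace A) * chebS q (trace B) *
        (chebS (Suc k) (trace ?C) * trace (A ** ?C) - chebS k (trace ?C) * trace A)
      - chebS p (trace A) * chebS (Suc q) (trace B) *
        (chebS (Suc k) (trace ?C) * trace (B ** ?C) - chebS k (trace ?C) * trace B)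
      + chebS p (trace A) * chebS q (trace B) *
        (chebS (Suc k) (trace ?C) * trace ?C - chebS k (trace ?C) * 2)"
    unfolding word3_def hom(2)[of "_ * _" "_ ^ _"] hom(2)[of "_ ^ _" "_ ^ _"]
    by (rule lin) (use pow in \<open>simp_all only: hom\<close>)
  then show ?thesis
    by (simp only: trace_formula_def CC AAB BAB)
qed

text \<open>The witnesses are \<open>A = (x, -1; 1, 0)\<close> and \<open>B = (0, v; v - z, y)\<close> with \<open>v (v - z) = -1\<close>.\<close>

lemma SL2_traces_surj:
  obtains A B where "A \<in> SL2" "B \<in> SL2" "trace A = x" "trace B = y" "trace (A ** B) = z"
proof -
  \<comment> \<open>A root of v^2 - z v + 1 by the quadratic formula. It gives det B = 1, while AB
    has the diagonal entries z - v and v.\<close>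
  define v where "v = (z + csqrt (z ^ 2 - 4)) / 2"
  have "(2 * v - z) ^ 2 = z ^ 2 - 4"
    using power2_csqrt[of "z ^ 2 - 4"] by (simp add: v_def diff_divide_distrib add_divide_distrib)
  then have "4 * (v * (v - z)) = 4 * (-1)"
    by (simp add: power2_eq_square algebra_simps)
  then have v: "v * (v - z) = -1"
    by (simp only: mult_cancel_left) simp
  define A :: "complex^2^2" where "A = vector [vector [x, -1], vector [1, 0]]"
  define B :: "complex^2^2" where "B = vector [vector [0, v], vector [v - z, y]]"
  have "A \<in> SL2" "B \<in> SL2" "trace A = x" "trace B = y" "trace (A ** B) = z"
    using v by (simp_all add: A_def B_def SL2_def det_2 trace_def sum_2 matrix_matrix_mult_def)
  then show ?thesis by (rule that)
qed

section \<open>Uniqueness of trace polynomials\<close>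

lemma comm_ring_map_eval3: "comm_ring_map (\<lambda>f. eval3 f x y z)"
  unfolding eval3_def
  by (intro comm_ring_map.comm_ring_map_poly comm_ring_map_of_int)

text \<open>A polynomial over an infinite domain that vanishes everywhere is zero. Each use strips
  one variable, in the order z, y, x.\<close>

lemma coeff_vanishes_if_poly_map_poly_vanishes:
  fixes h :: "'a::zero \<Rightarrow> 'b::{idom,ring_char_0}"
  assumes "\<And>c. poly (map_poly h p) c = 0" "h 0 = 0"
  shows "h (coeff p k) = 0"
proof -
  have "map_poly h p = 0"
    using assms(1) poly_all_0_iff_0 by blast
  then show ?thesis
    using coeff_map_poly[of h p k] assms(2) by simp
qed

lemma eval3_eq_0_imp:
  assumes "\<And>x y z. eval3 f x y z = 0"
  shows "f = 0"
proof -
  have "poly (map_poly (\<lambda>h. poly (map_poly of_int h) x) (coeff f k)) y = 0" for x y :: complex and k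
    by (rule coeff_vanishes_if_poly_map_poly_vanishes) (use assms in \<open>simp_all add: eval3_def\<close>)
  then have "poly (map_poly of_int (coeff (coeff f k) j)) x = 0" for x :: complex and k j
    by (rule coeff_vanishes_if_poly_map_poly_vanishes) simp
  then have "(of_int (coeff (coeff (coeff f k) j) i) :: complex) = 0" for k j i
    by (rule coeff_vanishes_if_poly_map_poly_vanishes) simp
  then show ?thesis
    by (intro poly_eqI) simp
qed

text \<open>Every triple of complex numbers occurs as traces of A, B and AB, so the difference of
  two candidates vanishes on all of C^3 and is zero. This settles the definite description in
  \<open>trace_poly\<close>.\<close>

lemma trace_poly_eqI:
  assumes "\<And>A B. A \<in> SL2 \<Longrightarrow> B \<in> SL2 \<Longrightarrow>
    trace (word_mat A B w) = eval3 f (trace A) (trace B) (trace (A ** B))"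
  shows "trace_poly w = f"
  unfolding trace_poly_def
proof (rule the_equality)
  fix f' assume f': "\<forall>A\<in>SL2. \<forall>B\<in>SL2.
    trace (word_mat A B w) = eval3 f' (trace A) (trace B) (trace (A ** B))"
  interpret E: comm_ring_map "\<lambda>f. eval3 f x y z" for x y z by (rule comm_ring_map_eval3)
  have "eval3 (f' - f) x y z = 0" for x y z
  proof -
    obtain A B where "A \<in> SL2" "B \<in> SL2" "trace A = x" "trace B = y" "trace (A ** B) = z"
      using SL2_traces_surj .
    then show ?thesis using f' assms by (metis E.map_diff right_minus_eq)
  qed
  then show "f' = f" using eval3_eq_0_imp by fastforce
qed (use assms in blast)

section \<open>The coefficient of the top power of z\<close>

abbreviation "varX \<equiv> [:[:[:0, 1 :: int:]:]:]"
abbreviation "varY \<equiv> [:[:0, 1 :: int poly:]:]"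
abbreviation "varZ \<equiv> [:0, 1 :: int poly poly:]"

lemma trace_poly_word3:
  "trace_poly (word3 (Suc p) (Suc q) (Suc k)) = trace_formula p q k varX varY varZ"
proof (rule trace_poly_eqI)
  fix A B :: "complex^2^2"
  assume "A \<in> SL2" "B \<in> SL2"
  interpret E: comm_ring_map "\<lambda>f. eval3 f x y z" for x y z by (rule comm_ring_map_eval3)
  have "eval3 varX x y z = x" "eval3 varY x y z = y" "eval3 varZ x y z = z" for x y z
    by (simp_all add: eval3_def map_poly_pCons)
  then show "trace (word_mat A B (word3 (Suc p) (Suc q) (Suc k))) =
      eval3 (trace_formula p q k varX varY varZ) (trace A) (trace B) (trace (A ** B))"
    using \<open>A \<in> SL2\<close> \<open>B \<in> SL2\<close> by (simp add: trace_word3 E.map_trace_formula)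
qed

text \<open>As a polynomial in z, \<open>chebS (Suc k)\<close> is monic of degree k, so its product
  with z^2 is monic of degree k + 2. All other contributions have degree at most k + 1.\<close>

lemma coeff_trace_formula:
  fixes x y :: "'a::comm_ring_1"
  shows "coeff (trace_formula p q k [:x:] [:y:] [:0, 1:]) (Suc (Suc k)) =
    chebS (Suc p) x * chebS (Suc q) y"
proof -
  let ?Z = "[:0, 1 :: 'a:]"
  have two: "(2 :: 'a poly) = [:2:]"
    by (simp add: numeral_poly)
  \<comment> \<open>Products with z become shifts by \<open>pCons\<close> and constants become
    scalars, so coefficients can be read off directly.\<close>
  have eq:
    "[:a:] * [:b:] * (S * (?Z * ?Z - [:2:]) - S' * ?Z) =
      smult (a * b) (pCons 0 (pCons 0 S) - smult 2 S - pCons 0 S')"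
    "[:a:] * [:b:] * (S * ([:c:] * ?Z - [:d:]) - S' * [:c:]) =
      smult (a * b) (smult c (pCons 0 S) - smult d S - smult c S')"
    "[:a:] * [:b:] * (S * ?Z - S' * [:2:]) = smult (a * b) (pCons 0 S - smult 2 S')"
    for a b c d and S S' :: "'a poly"
    by (simp_all add: right_diff_distrib smult_diff_right mult.commute)
  have zero: "coeff (chebS n ?Z) m = 0" if "n \<le> m" for m n
    using that by (rule coeff_chebS_eq_0)
  show ?thesis
    unfolding trace_formula_def chebS_poly_const two eq
    by (simp add: zero coeff_chebS_lead del: chebS.simps)
qed

lemma coeff_trace_poly_word3:
  "coeff (trace_poly (word3 (Suc p) (Suc q) (Suc k))) (Suc (Suc k)) =
    in_x (chebS (Suc p) [:0, 1:]) * in_y (chebS (Suc q) [:0, 1:])"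
proof -
  interpret C: comm_ring_map "\<lambda>c :: int. [:c:]" by (rule comm_ring_map_const)
  interpret Y: comm_ring_map "map_poly (\<lambda>c :: int. [:c:])" by (rule C.comm_ring_map_map_poly)
  have x: "in_x (chebS n [:0, 1:]) = chebS n [:[:0, 1:]:]" for n
    by (simp add: in_x_def chebS_poly_const)
  have y: "in_y (chebS n [:0, 1:]) = chebS n [:0, 1:]" for n
    by (simp add: in_y_def Y.map_chebS map_poly_pCons pCons_one)
  show ?thesis
    unfolding trace_poly_word3 coeff_trace_formula x y ..
qed


section \<open>Size of the coefficients\<close>

text \<open>Passing from i to i + 1 multiplies the binomial by (k + i + 1)/(i + 1), which is at
  least 2 as long as i + 1 <= k.\<close>

lemma two_power_le_binomial: "i \<le> k \<Longrightarrow> 2 ^ i \<le> (k + i) choose i"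
proof (induction i)
  case (Suc i)
  have "Suc i * (2 * 2 ^ i) \<le> Suc (k + i) * ((k + i) choose i)"
    using Suc mult_mono[of "Suc i * 2" "Suc (k + i)" "2 ^ i" "(k + i) choose i"] by simp
  also have "\<dots> = Suc i * ((k + Suc i) choose Suc i)"
    using Suc_times_binomial_eq[of "k + i" i] by simp
  finally show ?case
    by (simp only: mult_le_cancel1 power_Suc)
qed simp

lemma two_power_le_abs_coeff_chebS:
  assumes "3 * i \<le> n"
  shows "2 ^ i \<le> \<bar>coeff (chebS (Suc n) [:0, 1 :: int:]) (n - 2 * i)\<bar>"
proof -
  \<comment> \<open>For k = n - 2 i the condition i <= k reads 3 i <= n.\<close>
  have "2 ^ i \<le> ((n - 2 * i) + i) choose i"
    using assms by (intro two_power_le_binomial) simp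
  then have "(2 :: int) ^ i \<le> int (((n - 2 * i) + i) choose i)"
    by (metis of_nat_le_iff of_nat_numeral of_nat_power)
  also have "\<dots> = \<bar>coeff (chebS (Suc n) [:0, 1 :: int:]) (n - 2 * i)\<bar>"
    using coeff_chebS[of "n - 2 * i" i, where 'a = int] assms
    by (simp add: abs_mult power_abs del: chebS.simps)
  finally show ?thesis .
qed

lemma less_two_power_length_binary: "n < 2 ^ length (binary n)"
proof (induction n rule: binary.induct)
  case (1 n)
  then show ?case by (subst binary.simps) auto
qed

lemma less_bit_length:
  assumes "2 ^ k \<le> \<bar>c\<bar>"
  shows "k < bit_length c"
proof -
  have "(2 :: nat) ^ k \<le> nat \<bar>c\<bar>"
    using assms by (simp add: le_nat_iff)
  also have "\<dots> < 2 ^ bit_length c"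
    unfolding bit_length_def by (rule less_two_power_length_binary)
  finally show ?thesis by simp
qed

section \<open>Supports and bit norms\<close>

lemma coeff2_in_x_times_in_y: "coeff2 (in_x p * in_y q) (i, j) = coeff p i * coeff q j"
  by (simp add: coeff2_def in_x_def in_y_def coeff_map_poly)

lemma finite_support2: "finite {e. coeff2 g e \<noteq> 0}"
proof (rule finite_subset)
  show "{e. coeff2 g e \<noteq> 0} \<subseteq> (\<Union>j\<le>degree g. (\<lambda>i. (i, j)) ` {..degree (coeff g j)})"
    by (force simp: coeff2_def intro: le_degree dest: coeff_eq_0 split: prod.splits)
qed simp

text \<open>Needed because cardinalities of infinite sets and sums over them are 0 by
  convention.\<close>

lemma finite_supp3: "finite (supp3 f)"
proof (rule finite_subset)
  show "supp3 f \<subseteq> (\<Union>k\<le>degree f. (\<lambda>(i, j). (i, j, k)) ` {e. coeff2 (coeff f k) e \<noteq> 0})"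
  proof
    fix e assume "e \<in> supp3 f"
    then obtain i j k where e: "e = (i, j, k)" "coeff2 (coeff f k) (i, j) \<noteq> 0"
      by (cases e) (auto simp: supp3_def coeff3_def coeff2_def)
    then have "coeff f k \<noteq> 0" by (auto simp: coeff2_def)
    then have "k \<le> degree f" by (rule le_degree)
    with e show "e \<in> (\<Union>k\<le>degree f. (\<lambda>(i, j). (i, j, k)) ` {e. coeff2 (coeff f k) e \<noteq> 0})"
      by force
  qed
qed (simp add: finite_support2)

text \<open>Attaching the fixed z-exponent k embeds the support of the coefficient of z^k into that
  of f and preserves coefficients.\<close>

lemma
  shows bit_norm2_coeff_le: "bit_norm2 (coeff f k) \<le> bit_norm3 f"
    and card_support2_coeff_le: "card {e. coeff2 (coeff f k) e \<noteq> 0} \<le> card (supp3 f)"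
proof -
  let ?\<phi> = "\<lambda>(i, j). (i, j, k)" and ?T = "{e. coeff2 (coeff f k) e \<noteq> 0}"
  have inj: "inj_on ?\<phi> ?T" by (auto simp: inj_on_def)
  have sub: "?\<phi> ` ?T \<subseteq> supp3 f"
    by (auto simp: supp3_def coeff3_def coeff2_def)
  show "card ?T \<le> card (supp3 f)"
    by (rule card_inj_on_le[OF inj sub finite_supp3])
  have "bit_norm2 (coeff f k) = (\<Sum>e\<in>?\<phi> ` ?T. bit_length (coeff3 f e))"
    unfolding bit_norm2_def sum.reindex[OF inj]
    by (rule sum.cong) (auto simp: coeff2_def coeff3_def)
  also have "\<dots> \<le> bit_norm3 f"
    unfolding bit_norm3_def by (rule sum_mono2[OF finite_supp3 sub]) simp
  finally show "bit_norm2 (coeff f k) \<le> bit_norm3 f" .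
qed

text \<open>Over the (h + 1)^2 pairs, i and j have mean h/2 each, so the summand has mean h +
  1.\<close>

lemma sum_sum_add_1: "(\<Sum>i\<le>h. \<Sum>j\<le>h. i + j + 1) = (h + 1) ^ 3" for h :: nat
proof -
  have s: "2 * (\<Sum>i\<le>h. i) = h * (h + 1)"
    by (induction h) auto
  have "(\<Sum>i\<le>h. \<Sum>j\<le>h. i + j + 1) = (\<Sum>i\<le>h. (h + 1) * i + ((\<Sum>j\<le>h. j) + (h + 1)))"
    by (simp only: sum.distrib sum_constant card_atMost of_nat_id) simp
  also have "\<dots> = (h + 1) * (2 * (\<Sum>i\<le>h. i)) + (h + 1) * (h + 1)"
    by (simp only: sum.distrib sum_constant card_atMost of_nat_id sum_distrib_left[symmetric])
      (simp add: algebra_simps)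
  also have "\<dots> = (h + 1) ^ 3"
    by (simp only: s) (simp add: power3_eq_cube algebra_simps)
  finally show ?thesis .
qed

text \<open>Only the exponent pairs \<open>(p - 2 i, q - 2 j)\<close> with \<open>i, j \<le> h\<close> are counted: their coefficients
  have absolute value at least \<open>2^(i + j)\<close>.\<close>

lemma
  assumes "3 * h \<le> p" "3 * h \<le> q"
  defines "g \<equiv> in_x (chebS (Suc p) [:0, 1:]) * in_y (chebS (Suc q) [:0, 1:])"
  shows bit_norm2_chebS_ge: "(h + 1) ^ 3 \<le> bit_norm2 g"
    and card_support2_chebS_ge: "(h + 1) ^ 2 \<le> card {e. coeff2 g e \<noteq> 0}"
proof -
  let ?\<phi> = "\<lambda>(i, j). (p - 2 * i, q - 2 * j)" and ?T = "{..h} \<times> {..h}"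
  \<comment> \<open>The subtractions are not truncated at 0, since 3 h <= p and 3 h <= q.\<close>
  have inj: "inj_on ?\<phi> ?T"
    using assms by (auto simp: inj_on_def)
  have large: "2 ^ (i + j) \<le> \<bar>coeff2 g (?\<phi> (i, j))\<bar>" if "i \<le> h" "j \<le> h" for i j
  proof -
    have "3 * i \<le> p" "3 * j \<le> q" using that assms by auto
    then show ?thesis
      unfolding g_def prod.case coeff2_in_x_times_in_y abs_mult power_add
      by (intro mult_mono two_power_le_abs_coeff_chebS) auto
  qed
  have nz: "coeff2 g (?\<phi> (i, j)) \<noteq> 0" if "i \<le> h" "j \<le> h" for i j
  proof -
    have "0 < (2 :: int) ^ (i + j)" by simp
    then show ?thesis using large[OF that] by linarith
  qed
  have sub: "?\<phi> ` ?T \<subseteq> {e. coeff2 g e \<noteq> 0}"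
    using nz by auto
  show "(h + 1) ^ 2 \<le> card {e. coeff2 g e \<noteq> 0}"
    using card_inj_on_le[OF inj sub finite_support2] by (simp add: power2_eq_square)
  have "(h + 1) ^ 3 = (\<Sum>(i, j)\<in>?T. i + j + 1)"
    by (simp only: sum_sum_add_1[symmetric] sum.cartesian_product)
  \<comment> \<open>An integer of absolute value at least 2^(i + j) has at least i + j + 1 binary
    digits.\<close>
  also have "\<dots> \<le> (\<Sum>e\<in>?T. bit_length (coeff2 g (?\<phi> e)))"
  proof (rule sum_mono)
    fix e assume "e \<in> ?T"
    then obtain i j where e: "e = (i, j)" "i \<le> h" "j \<le> h" by auto
    show "(case e of (i, j) \<Rightarrow> i + j + 1) \<le> bit_length (coeff2 g (?\<phi> e))"
      using less_bit_length[OF large[OF e(2,3)]] by (simp add: e(1))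
  qed
  also have "\<dots> = (\<Sum>e\<in>?\<phi> ` ?T. bit_length (coeff2 g e))"
    by (simp add: sum.reindex[OF inj])
  also have "\<dots> \<le> bit_norm2 g"
    unfolding bit_norm2_def by (rule sum_mono2[OF finite_support2 sub]) simp
  finally show "(h + 1) ^ 3 \<le> bit_norm2 g" .
qed

lemma
  assumes "1 \<le> m" "m \<le> p" "m \<le> q" "1 \<le> k"
  defines "f \<equiv> trace_poly (word3 p q k)"
  shows bit_norm2_word3_ge: "m ^ 3 \<le> 27 * bit_norm2 (coeff f (k + 1))"
    and bit_norm3_word3_ge: "m ^ 3 \<le> 27 * bit_norm3 f"
    and card_supp3_word3_ge: "m ^ 2 \<le> 9 * card (supp3 f)"
proof -
  \<comment> \<open>The largest h with 3 h <= m - 1, where m - 1 bounds the degrees p - 1 and q - 1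
    from below. Rounding leaves m <= 3 (h + 1), whence the constants 27 = 3^3 and 9 = 3^2.\<close>
  define h where "h = (m - 1) div 3"
  obtain p' q' k' where suc: "p = Suc p'" "q = Suc q'" "k = Suc k'"
    using assms by (metis Suc_le_D One_nat_def)
  have coeff_eq: "coeff f (k + 1) = in_x (chebS (Suc p') [:0, 1:]) * in_y (chebS (Suc q') [:0, 1:])"
    unfolding f_def suc by (simp add: coeff_trace_poly_word3 del: chebS.simps)
  have h: "m \<le> 3 * (h + 1)" "3 * h \<le> p'" "3 * h \<le> q'"
    using assms by (auto simp: h_def suc)
  have "m ^ 3 \<le> (3 * (h + 1)) ^ 3"
    using h(1) by (rule power_mono) simp
  also have "\<dots> = 27 * (h + 1) ^ 3"
    by (simp only: power_mult_distrib) simp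
  also have "\<dots> \<le> 27 * bit_norm2 (coeff f (k + 1))"
    unfolding coeff_eq using bit_norm2_chebS_ge[OF h(2,3)] by (simp del: chebS.simps)
  finally show *: "m ^ 3 \<le> 27 * bit_norm2 (coeff f (k + 1))" .
  also have "\<dots> \<le> 27 * bit_norm3 f"
    using bit_norm2_coeff_le by simp
  finally show "m ^ 3 \<le> 27 * bit_norm3 f" .
  have "m ^ 2 \<le> (3 * (h + 1)) ^ 2"
    using h(1) by (rule power_mono) simp
  also have "\<dots> = 9 * (h + 1) ^ 2"
    by (simp only: power_mult_distrib) simp
  also have "\<dots> \<le> 9 * card (supp3 f)"
    using card_support2_chebS_ge[OF h(2,3)] card_support2_coeff_le[of f "k + 1"]
    unfolding coeff_eq by (simp del: chebS.simps)
  finally show "m ^ 2 \<le> 9 * card (supp3 f)" .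
qed


section \<open>Lengths of positive words\<close>

text \<open>Without inverse letters nothing cancels, so lengths add up and cyclic reduction changes
  nothing.\<close>

definition positive_word :: "letter list \<Rightarrow> bool" where
  "positive_word w \<longleftrightarrow> (\<forall>l\<in>set w. \<not> snd l)"

lemma freely_reduced_if_positive: "positive_word w \<Longrightarrow> freely_reduced w"
proof (induction w)
  case (Cons l w)
  then show ?case
    by (cases w) (auto simp: freely_reduced_Cons positive_word_def letter_inv_def)
qed simp

lemma reduced_word_times_if_positive:
  assumes "positive_word (reduced_word g)" "positive_word (reduced_word h)"
  shows "reduced_word (g * h) = reduced_word g @ reduced_word h"
  using assms
  by (simp add: times_free_grp.rep_eq free_reduce_reduced freely_reduced_if_positive positive_word_def ball_Un)

lemma positive_times:
  assumes "positive_word (reduced_word g)" "positive_word (reduced_word h)"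
  shows "positive_word (reduced_word (g * h))" "red_length (g * h) = red_length g + red_length h"
  using assms reduced_word_times_if_positive[OF assms] by (auto simp: positive_word_def red_length_def)

lemma positive_power:
  assumes "positive_word (reduced_word g)"
  shows "positive_word (reduced_word (g ^ n)) \<and> red_length (g ^ n) = n * red_length g"
proof (induction n)
  case 0
  then show ?case by (simp add: positive_word_def red_length_def one_free_grp.rep_eq)
next
  case (Suc n)
  then show ?case using positive_times[OF assms] by simp
qed

lemma
  shows positive_word3: "positive_word (reduced_word (word3 p q k))"
    and red_length_word3: "red_length (word3 p q k) = p + q + 2 * k"
proof -
  have a: "positive_word (reduced_word gen_a)" "red_length gen_a = 1"
    by (simp_all add: gen_a.rep_eq positive_word_def red_length_def)
  have b: "positive_word (reduced_word gen_b)" "red_length gen_b = 1"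
    by (simp_all add: gen_b.rep_eq positive_word_def red_length_def)
  show "positive_word (reduced_word (word3 p q k))" "red_length (word3 p q k) = p + q + 2 * k"
    by (simp_all add: word3_def positive_times positive_power a b)
qed

lemma cyclic_reduce_if_positive:
  assumes "positive_word w"
  shows "cyclic_reduce w = w"
proof -
  have "last w \<noteq> letter_inv (hd w)" if "length w \<ge> 2"
  proof -
    have "hd w \<in> set w" "last w \<in> set w"
      using that by (cases w; simp)+
    then show ?thesis
      using assms by (auto simp: positive_word_def letter_inv_def)
  qed
  then show ?thesis
    by (subst cyclic_reduce.simps) auto
qed

lemma cyc_length_word3: "cyc_length (word3 p q k) = p + q + 2 * k"
  using cyclic_reduce_if_positive[OF positive_word3, of p q k] red_length_word3[of p q k]
  by (simp add: cyc_length_def red_length_def)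

text \<open>Makes the maxima over all words of length n bound each single word.\<close>

lemma finite_red_length_eq: "finite {w. red_length w = n}"
proof (rule finite_imageD)
  have "finite (UNIV :: gen set)"
    by (rule finite_subset[of _ "{GenA, GenB}"]) (auto intro: gen.exhaust)
  then have "finite (UNIV :: letter set)"
    by (simp add: finite_prod)
  then have "finite {xs :: letter list. set xs \<subseteq> UNIV \<and> length xs = n}"
    by (rule finite_lists_length_eq)
  then show "finite (reduced_word ` {w. red_length w = n})"
    by (rule finite_subset[rotated]) (auto simp: red_length_def)
  show "inj_on reduced_word {w. red_length w = n}"
    by (simp add: inj_on_def reduced_word_inject)
qed


section \<open>Output size and running time\<close>

text \<open>The coefficient digits alone give the bound; signs, separators and exponent data only
  lengthen the output. Hence it holds for every decoding function.\<close>

lemma bit_norm3_le_length_sparse_binary_form: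
  assumes "sparse_binary_form dec f s"
  shows "bit_norm3 f \<le> length s"
proof -
  obtain ts where ts: "distinct (map fst ts)" "set (map fst ts) = supp3 f"
    and s: "s = concat (map (\<lambda>(e, d). map Expo d @ coeff_code (coeff3 f e) @ [Sep]) ts)"
    using assms by (auto simp: sparse_binary_form_def)
  have "bit_norm3 f = sum_list (map (\<lambda>e. bit_length (coeff3 f e)) (map fst ts))"
    unfolding bit_norm3_def ts(2)[symmetric] by (rule sum_list_distinct_conv_sum_set[OF ts(1), symmetric])
  also have "\<dots> \<le> length s"
    unfolding s length_concat map_map
    by (rule sum_list_mono) (auto simp: coeff_code_def bit_length_def)
  finally show ?thesis .
qed

text \<open>The input alphabet is disjoint from the output alphabet, so output symbols are only written
  by the machine, at most one per step on the output tape, even if it is also the input tape.\<close>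

lemma card_out_cells_le:
  fixes M :: "('q, 'k, ('e, 'w) tape_sym) machine"
  shows "finite {i. \<exists>s. cells (run M w t) k i = Out s} \<and>
    card {i. \<exists>s. cells (run M w t) k i = Out s} \<le> t"
proof (induction t)
  case 0
  have "{i. \<exists>s. cells (run M w 0) k i = Out s} = {}"
    by (auto simp: run_def init_config_def split: if_splits)
  then show ?case by simp
next
  case (Suc t)
  let ?c = "run M w t"
  let ?N = "insert (head ?c k) {i. \<exists>s. cells ?c k i = Out s}"
  have sub: "{i. \<exists>s. cells (run M w (Suc t)) k i = Out s} \<subseteq> ?N"
    by (auto simp: run_def step_def split: option.splits if_splits)
  have N: "finite ?N" "card ?N \<le> Suc t"
    using Suc by (simp_all add: card_insert_if)
  show ?case
    using finite_subset[OF sub N(1)] le_trans[OF card_mono[OF N(1) sub] N(2)] by (rule conjI)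
qed

text \<open>At halting, the output occupies distinct cells that all carry output symbols, and there
  are at most as many of these as steps.\<close>

lemma length_machine_output_le_running_time:
  fixes M :: "('q, 'k, ('e, 'w) tape_sym) machine"
  assumes "machine_output M w = map Out s"
  shows "length (machine_output M w) \<le> running_time M w"
proof -
  let ?tape = "cells (run M w (running_time M w)) (out_tape M)"
  let ?n = "length (machine_output M w)"
  let ?O = "{i. \<exists>s. ?tape i = Out s}"
  have "?tape (int i) = Out (s ! i)" if "i < ?n" for i
  proof -
    have "machine_output M w ! i = ?tape (int i)"
      using that by (simp add: machine_output_def Let_def)
    then show ?thesis using that assms by simp
  qed
  then have "int ` {..<?n} \<subseteq> ?O" by blast
  then have "card (int ` {..<?n}) \<le> card ?O"
    using card_out_cells_le[of M w _ "out_tape M"] by (intro card_mono) auto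
  also have "\<dots> \<le> running_time M w"
    using card_out_cells_le[of M w "running_time M w" "out_tape M"] by simp
  finally show ?thesis by (simp add: card_image)
qed

lemma
  fixes M :: "('q, 'k, ('e, 'w) tape_sym) machine"
  assumes M: "computes_trace_poly M dec" and n: "4 \<le> n"
  shows worst_output_size_ge: "n ^ 3 \<le> 9261 * worst_output_size M n"
    and worst_running_time_ge: "n ^ 3 \<le> 9261 * worst_running_time M n"
proof -
  define m where "m = n div 4"
  \<comment> \<open>The remainder mod 4 goes into the exponent of a, so that the length is exactly
    n.\<close>
  define w where "w = word3 (m + n mod 4) m m"
  have "n = 4 * m + n mod 4" "n mod 4 < 4"
    by (simp_all add: m_def)
  moreover from this n have "1 \<le> m"
    by linarith
  \<comment> \<open>n <= 4 m + 3 <= 7 m because m >= 1. The final constant is 9261 = 7^3 *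
    27.\<close>
  ultimately have m: "1 \<le> m" "n \<le> 7 * m"
    by linarith+
  have w: "red_length w = n"
    by (simp add: w_def red_length_word3 m_def)
  obtain s where s: "sparse_binary_form dec (trace_poly w) s" "machine_output M w = map Out s"
    using M by (auto simp: computes_trace_poly_def)
  have "n ^ 3 \<le> (7 * m) ^ 3"
    using m(2) by (rule power_mono) simp
  also have "\<dots> = 343 * m ^ 3"
    by (simp add: power_mult_distrib)
  also have "\<dots> \<le> 343 * (27 * bit_norm3 (trace_poly w))"
    using bit_norm3_word3_ge[of m "m + n mod 4" m m] m(1) by (simp add: w_def)
  also have "\<dots> \<le> 9261 * length (machine_output M w)"
    using bit_norm3_le_length_sparse_binary_form[OF s(1)] by (simp add: s(2))
  finally have *: "n ^ 3 \<le> 9261 * length (machine_output M w)" .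
  have "length (machine_output M w) \<le> worst_output_size M n"
    unfolding worst_output_size_def
    by (rule Max_ge) (use w finite_red_length_eq in auto)
  with * show "n ^ 3 \<le> 9261 * worst_output_size M n" by linarith
  have "running_time M w \<le> worst_running_time M n"
    unfolding worst_running_time_def
    by (rule Max_ge) (use w finite_red_length_eq in auto)
  with * length_machine_output_le_running_time[OF s(2)]
  show "n ^ 3 \<le> 9261 * worst_running_time M n" by linarith
qed

text \<open>Lets all estimates stay in the natural numbers; the real constant becomes 1/c.\<close>

lemma bigomega_powerI:
  fixes f :: "nat \<Rightarrow> nat"
  assumes "\<And>n. N \<le> n \<Longrightarrow> n ^ d \<le> c * f n" "c > 0"
  shows "(\<lambda>n. real (f n)) \<in> \<Omega>(\<lambda>n. real n ^ d)"
proof (rule landau_omega.bigI)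
  show "\<forall>\<^sub>F n in at_top. 1 / real c * norm (real n ^ d) \<le> norm (real (f n))"
    using eventually_ge_at_top[of N]
  proof eventually_elim
    case (elim n)
    have "real (n ^ d) \<le> real (c * f n)"
      using assms(1)[OF elim] by (simp only: of_nat_le_iff)
    then show ?case using assms(2) by (simp add: field_simps)
  qed
qed (use assms(2) in simp)

theorem theorem1p7:
  shows "(\<forall>m\<ge>1. red_length (word_w m) = 4 * m \<and> cyc_length (word_w m) = 4 * m) \<and>
    (\<forall>m\<ge>1. g_poly m = in_x (E_poly m) * in_y (E_poly m)) \<and>
    ((\<lambda>m. real (card (supp3 (trace_poly (word_w m))))) \<in> \<Omega>(\<lambda>m. real m ^ 2)) \<and>
    ((\<lambda>m. real (bit_norm2 (g_poly m))) \<in> \<Omega>(\<lambda>m. real m ^ 3)) \<and>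
    ((\<lambda>m. real (bit_norm3 (trace_poly (word_w m)))) \<in> \<Omega>(\<lambda>m. real m ^ 3)) \<and>
    (\<forall>(M :: ('q::finite, 'k::finite, ('e::finite, 'w::finite) tape_sym) machine) dec.
       computes_trace_poly M dec \<longrightarrow>
         (\<lambda>n. real (worst_output_size M n)) \<in> \<Omega>(\<lambda>n. real n ^ 3) \<and>
         (\<lambda>n. real (worst_running_time M n)) \<in> \<Omega>(\<lambda>n. real n ^ 3))"
proof (intro conjI allI impI)
  fix m :: nat assume m: "1 \<le> m"
  show "red_length (word_w m) = 4 * m" "cyc_length (word_w m) = 4 * m"
    by (simp_all add: word_w_eq_word3 red_length_word3 cyc_length_word3)
  obtain m' where "m = Suc m'" using m by (cases m) auto
  then show "g_poly m = in_x (E_poly m) * in_y (E_poly m)"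
    using coeff_trace_poly_word3[of m' m' m']
    by (simp add: g_poly_def word_w_eq_word3 E_poly_eq del: chebS.simps)
next
  show "(\<lambda>m. real (card (supp3 (trace_poly (word_w m))))) \<in> \<Omega>(\<lambda>m. real m ^ 2)"
    unfolding word_w_eq_word3
    by (rule bigomega_powerI[of 1 _ 9]) (simp_all add: card_supp3_word3_ge)
  show "(\<lambda>m. real (bit_norm2 (g_poly m))) \<in> \<Omega>(\<lambda>m. real m ^ 3)"
    unfolding g_poly_def word_w_eq_word3
    by (rule bigomega_powerI[of 1 _ 27]) (use bit_norm2_word3_ge in auto)
  show "(\<lambda>m. real (bit_norm3 (trace_poly (word_w m)))) \<in> \<Omega>(\<lambda>m. real m ^ 3)"
    unfolding word_w_eq_word3
    by (rule bigomega_powerI[of 1 _ 27]) (simp_all add: bit_norm3_word3_ge)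
next
  fix M :: "('q, 'k, ('e, 'w) tape_sym) machine" and dec
  assume "computes_trace_poly M dec"
  then show "(\<lambda>n. real (worst_output_size M n)) \<in> \<Omega>(\<lambda>n. real n ^ 3)"
    "(\<lambda>n. real (worst_running_time M n)) \<in> \<Omega>(\<lambda>n. real n ^ 3)"
    \<comment> \<open>The bounds start at n = 4, the least n for which n div 4 is positive.\<close>
    by (auto intro!: bigomega_powerI[of 4 _ 9261] worst_output_size_ge worst_running_time_ge)
qed

end
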